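(* There exist a short exact sequence of groups $1\to Q_8 \to G' \stackrel{q}{\to} G\to 1$ and commuting elements $\alpha,\beta$ generating $G$ such that the homology class $\kappa_{\alpha,\beta}\in H_2(G;\mathbb{Z})$ lies in the image of the induced homomorphism $q_*:H_2(G';\mathbb{Z})\to H_2(G;\mathbb{Z})$, and nevertheless $L(\alpha,\beta,q)=\emptyset$, i.e. there is no pair $(a,b)\in G'\times G'$ with $q(a)=\alpha$, $q(b)=\beta$ and $ab=ba$.
   Context: $Q_8=\{\pm1,\pm i,\pm j,\pm k\}$ is the quaternion group of order $8$. For commuting elements $\alpha,\beta$ of a group $G$, let $g:\mathbb{Z}^2\to G$ be the homomorphism carrying the standard generators of $\mathbb{Z}^2$ to $\alpha$ and $\beta$ respectively. Then $\kappa_{\alpha,\beta}\in H_2(G;\mathbb{Z})$ denotes the image of a generator of $H_2(\mathbb{Z}^2;\mathbb{Z})\cong\mathbb{Z}$ under $g_*:H_2(\mathbb{Z}^2;\mathbb{Z})\to H_2(G;\mathbb{Z})$ (group homology with trivial integer coefficients); it is well defined up to multiplication by $-1$. *)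

theory Defs
  imports "HOL-Algebra.Exact_Sequence" "HOL-Algebra.Free_Abelian_Groups"
begin

section \<open>The quaternion group\<close>

text \<open>A quadruple (a, b, c, d) stands for the integral Hamilton quaternion a + bi + cj + dk.\<close>

type_synonym int_quaternion = "int \<times> int \<times> int \<times> int"

fun quat_mult :: "int_quaternion \<Rightarrow> int_quaternion \<Rightarrow> int_quaternion" where
  "quat_mult (a, b, c, d) (a', b', c', d') =
     (a * a' - b * b' - c * c' - d * d',
      a * b' + b * a' + c * d' - d * c',
      a * c' - b * d' + c * a' + d * b',
      a * d' + b * c' - c * b' + d * a')"

definition Q8 :: "int_quaternion monoid" where
  "Q8 = \<lparr>carrier = {(1, 0, 0, 0), (-1, 0, 0, 0), (0, 1, 0, 0), (0, -1, 0, 0),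
                    (0, 0, 1, 0), (0, 0, -1, 0), (0, 0, 0, 1), (0, 0, 0, -1)},
         monoid.mult = quat_mult, one = (1, 0, 0, 0)\<rparr>"


section \<open>Short exact sequences\<close>

text \<open>The library constant \<open>short_exact_sequence\<close> forces the three groups to share one carrier
  type; this is the same notion without that restriction. As in the library, the epimorphism
  comes before the monomorphism.\<close>

definition short_exact ::
    "('c, 'm) monoid_scheme \<Rightarrow> ('b, 'n) monoid_scheme \<Rightarrow> ('a, 'k) monoid_scheme
      \<Rightarrow> ('b \<Rightarrow> 'c) \<Rightarrow> ('a \<Rightarrow> 'b) \<Rightarrow> bool" where
  "short_exact C B A q i \<longleftrightarrow>
     group A \<and> group B \<and> group C \<and> i \<in> mon A B \<and> q \<in> epi B C \<and>
     i ` carrier A = kernel B C q"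


section \<open>Group homology with trivial integer coefficients\<close>

text \<open>Homology of the inhomogeneous bar complex: the chains of degree n are the free abelian
  group on the symbols \<open>[x\<^sub>1 | \<dots> | x\<^sub>n]\<close>, represented by lists of length n, with
  \<open>d [x\<^sub>1 | \<dots> | x\<^sub>n] = [x\<^sub>2 | \<dots> | x\<^sub>n]
     + (\<Sum>0<i<n. (-1)\<^sup>i [x\<^sub>1 | \<dots> | x\<^sub>i x\<^sub>i\<^sub>+\<^sub>1 | \<dots> | x\<^sub>n]) + (-1)\<^sup>n [x\<^sub>1 | \<dots> | x\<^sub>n\<^sub>-\<^sub>1]\<close>.\<close>

definition bar_chain_group :: "nat \<Rightarrow> ('a, 'm) monoid_scheme \<Rightarrow> ('a list \<Rightarrow>\<^sub>0 int) monoid" where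
  "bar_chain_group n G = free_Abelian_group {xs. length xs = n \<and> set xs \<subseteq> carrier G}"

definition bar_face :: "('a, 'm) monoid_scheme \<Rightarrow> nat \<Rightarrow> 'a list \<Rightarrow> 'a list" where
  "bar_face G i xs =
     (if i = 0 then tl xs
      else if i = length xs then butlast xs
      else take (i - 1) xs @ (xs ! (i - 1) \<otimes>\<^bsub>G\<^esub> xs ! i) # drop (i + 1) xs)"

definition bar_boundary ::
    "('a, 'm) monoid_scheme \<Rightarrow> ('a list \<Rightarrow>\<^sub>0 int) \<Rightarrow> ('a list \<Rightarrow>\<^sub>0 int)" where
  "bar_boundary G =
     frag_extend (\<lambda>xs. if xs = [] then 0
       else (\<Sum>i\<le>length xs. frag_cmul ((-1) ^ i) (frag_of (bar_face G i xs))))"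

definition bar_cycle_group :: "nat \<Rightarrow> ('a, 'm) monoid_scheme \<Rightarrow> ('a list \<Rightarrow>\<^sub>0 int) monoid" where
  "bar_cycle_group n G =
     subgroup_generated (bar_chain_group n G)
       {c \<in> carrier (bar_chain_group n G). bar_boundary G c = 0}"

definition bar_boundaries :: "nat \<Rightarrow> ('a, 'm) monoid_scheme \<Rightarrow> ('a list \<Rightarrow>\<^sub>0 int) set" where
  "bar_boundaries n G = bar_boundary G ` carrier (bar_chain_group (Suc n) G)"

definition group_homology ::
    "nat \<Rightarrow> ('a, 'm) monoid_scheme \<Rightarrow> ('a list \<Rightarrow>\<^sub>0 int) set monoid" where
  "group_homology n G = bar_cycle_group n G Mod bar_boundaries n G"

text \<open>For a homomorphism f into H, the class (coset) \<open>\<xi>\<close> is sent to the class of \<open>f\<^sub># c\<close> for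
  any representative c of \<open>\<xi>\<close>.\<close>

definition group_homology_map ::
    "nat \<Rightarrow> ('b, 'm) monoid_scheme \<Rightarrow> ('a \<Rightarrow> 'b)
      \<Rightarrow> ('a list \<Rightarrow>\<^sub>0 int) set \<Rightarrow> ('b list \<Rightarrow>\<^sub>0 int) set" where
  "group_homology_map n H f \<xi> =
     the_elem ((\<lambda>c. bar_boundaries n H #>\<^bsub>bar_cycle_group n H\<^esub>
                     frag_extend (\<lambda>xs. frag_of (map f xs)) c) ` \<xi>)"


section \<open>The classes of commuting pairs, and commuting lifts\<close>

abbreviation Z_squared :: "(int \<times> int) monoid" where
  "Z_squared \<equiv> integer_group \<times>\<times> integer_group"

text \<open>A predicate rather than a function, because the class depends on the choice of a generator
  of the infinite cyclic group \<open>H\<^sub>2(Z\<^sup>2; Z)\<close> and so is determined only up to sign.\<close>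

definition is_kappa ::
    "('a, 'm) monoid_scheme \<Rightarrow> 'a \<Rightarrow> 'a \<Rightarrow> ('a list \<Rightarrow>\<^sub>0 int) set \<Rightarrow> bool" where
  "is_kappa G \<alpha> \<beta> \<kappa> \<longleftrightarrow>
     (\<exists>g \<xi>. g \<in> hom Z_squared G \<and> g (1, 0) = \<alpha> \<and> g (0, 1) = \<beta> \<and>
            \<xi> \<in> carrier (group_homology 2 Z_squared) \<and>
            generate (group_homology 2 Z_squared) {\<xi>} = carrier (group_homology 2 Z_squared) \<and>
            \<kappa> = group_homology_map 2 G g \<xi>)"

definition commuting_lifts ::
    "('b, 'm) monoid_scheme \<Rightarrow> 'a \<Rightarrow> 'a \<Rightarrow> ('b \<Rightarrow> 'a) \<Rightarrow> ('b \<times> 'b) set" where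
  "commuting_lifts G' \<alpha> \<beta> q =
     {(a, b). a \<in> carrier G' \<and> b \<in> carrier G' \<and> q a = \<alpha> \<and> q b = \<beta> \<and>
              a \<otimes>\<^bsub>G'\<^esub> b = b \<otimes>\<^bsub>G'\<^esub> a}"

end

theory Submission
  imports Defs "HOL-Algebra.Weak_Morphisms" "HOL-Library.Product_Plus"
begin

text \<open>Let \<open>G = Z\<^sup>2\<close>, and let \<open>G'\<close> be generated by \<open>Q\<^sub>8\<close> and two elements a and b, where a permutes i, j, k
  cyclically by conjugation, b centralizes \<open>Q\<^sub>8\<close> and \<open>ab = -ba\<close>. The lifts \<open>pa\<close> and \<open>qb\<close> of the two
  generators commute iff \<open>p a(q) p\<^sup>-\<^sup>1 = -q\<close>; as conjugation by p fixes q up to sign, this makes \<open>a(q) = q\<close>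
  or \<open>a(q) = -q\<close>, so q is 1 or -1, for which it fails. On the other hand \<open>-1 = iji\<^sup>-\<^sup>1j\<^sup>-\<^sup>1\<close> is a commutator
  of elements of the kernel, and gluing the punctured torus of (a, b) to that of (i, j) gives a
  2-cycle of \<open>G'\<close> lying over the torus of the two generators of G.

  That \<open>[x|y] - [y|x]\<close>, for the standard generators x and y, represents a generator of
  \<open>H\<^sub>2(Z\<^sup>2; Z)\<close> is seen from the universal 2-cocycle, with values in the 2-chains modulo boundaries:
  in the central extension that it classifies, elements of the form \<open>u\<^sup>m v\<^sup>n\<close> are a section whose
  cocycle takes values in the powers of the commutator of u and v.\<close>

section \<open>Powers of two elements with central commutator\<close>

lemma (in group) conj_int_pow:
  assumes "u \<in> carrier G" "x \<in> carrier G"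
  shows "u \<otimes> x [^] (n :: int) \<otimes> inv u = (u \<otimes> x \<otimes> inv u) [^] n"
proof -
  have "(\<lambda>x. u \<otimes> x \<otimes> inv u) \<in> hom G G"
  proof (rule homI)
    fix x y assume "x \<in> carrier G" "y \<in> carrier G"
    then show "u \<otimes> (x \<otimes> y) \<otimes> inv u = u \<otimes> x \<otimes> inv u \<otimes> (u \<otimes> y \<otimes> inv u)"
      using assms by (simp add: m_assoc inv_solve_left flip: m_assoc[of "inv u" u])
  qed (use assms in simp)
  then interpret group_hom G G "\<lambda>x. u \<otimes> x \<otimes> inv u"
    by unfold_locales
  show ?thesis using hom_int_pow[OF assms(2)] .
qed

text \<open>Conjugation by \<open>u\<close> takes \<open>v\<close> to \<open>c v\<close>. Since
  \<open>c\<close> and \<open>v\<close> commute, it takes the n-th power of \<open>v\<close> to the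
  product of the n-th powers of \<open>c\<close> and \<open>v\<close>.\<close>

lemma (in group) central_commutator_pow_right:
  assumes "u \<in> carrier G" "v \<in> carrier G" "c \<in> carrier G"
    and vc: "v \<otimes> c = c \<otimes> v" and uv: "u \<otimes> v = c \<otimes> v \<otimes> u"
  shows "u \<otimes> v [^] (n :: int) = c [^] n \<otimes> v [^] n \<otimes> u"
proof -
  have "u \<otimes> v \<otimes> inv u = c \<otimes> v"
    using assms by (simp add: uv inv_solve_right')
  then have "u \<otimes> v [^] n \<otimes> inv u = c [^] n \<otimes> v [^] n"
    using assms by (simp add: conj_int_pow int_pow_mult_distrib)
  then show ?thesis
    using assms by (simp add: inv_solve_right')
qed

text \<open>Two uses of the previous lemma: the first moves \<open>u\<close> past
  \<open>v^n\<close>; the second takes \<open>v^n\<close> and \<open>u\<close> as the pair, with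
  commutator \<open>c^(-n)\<close>.\<close>

lemma (in group) central_commutator_pow:
  assumes car: "u \<in> carrier G" "v \<in> carrier G" "c \<in> carrier G"
    and uc: "u \<otimes> c = c \<otimes> u" and vc: "v \<otimes> c = c \<otimes> v" and uv: "u \<otimes> v = c \<otimes> v \<otimes> u"
  shows "v [^] (n :: int) \<otimes> u [^] (m :: int) = c [^] (- (n * m)) \<otimes> u [^] m \<otimes> v [^] n"
proof -
  let ?w = "v [^] n" and ?d = "c [^] (- n)"
  have car': "?w \<in> carrier G" "?d \<in> carrier G" using car by auto
  \<comment> \<open>This is the instance with trivial commutator, for the commuting pair
    \<open>u\<close> and \<open>c\<close>.\<close>
  have ud: "u \<otimes> ?d = ?d \<otimes> u"
    using central_commutator_pow_right[of u c \<one> "- n"] car uc by (simp del: int_pow_neg)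
  have "u \<otimes> ?w = c [^] n \<otimes> ?w \<otimes> u"
    using central_commutator_pow_right[OF car(1,2,3) vc uv] .
  then have wu: "?w \<otimes> u = ?d \<otimes> u \<otimes> ?w"
    using car by (simp add: m_assoc inv_solve_left int_pow_neg)
  have "?w \<otimes> u [^] m = ?d [^] m \<otimes> u [^] m \<otimes> ?w"
    using central_commutator_pow_right[OF car'(1) car(1) car'(2) ud wu] .
  moreover have "?d [^] m = c [^] (- (n * m))"
    using car by (simp add: int_pow_pow)
  ultimately show ?thesis by simp
qed

section \<open>Two-cocycles on the free abelian group of rank two\<close>

text \<open>Up to the coboundary of \<open>s\<close>, a 2-cocycle on Z^2 is a power of the single
  element \<open>c\<close> with bilinear exponent. In the extension \<open>E\<close>,
  \<open>c\<close> is the commutator of lifts \<open>u\<close>, \<open>v\<close> of the generators,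
  and the ordered products \<open>u^m v^n\<close> form a section that multiplies according to
  \<open>central_commutator_pow\<close>.\<close>

lemma (in comm_group) cocycle_Z_squared:
  fixes f :: "int \<times> int \<Rightarrow> int \<times> int \<Rightarrow> 'a"
  assumes f [simp]: "\<And>x y. f x y \<in> carrier G"
    and cocycle: "\<And>x y z. f y z \<otimes> f x (y + z) = f (x + y) z \<otimes> f x y"
  defines "c \<equiv> f (1, 0) (0, 1) \<otimes> inv f (0, 1) (1, 0)"
  obtains s where "\<And>x. s x \<in> carrier G"
    "\<And>x y. f x y \<otimes> s x \<otimes> s y = c [^] (- (snd x * fst y)) \<otimes> s (x + y)"
proof -
  \<comment> \<open>The cocycle may be unnormalised: \<open>e\<close> is the common value of
    \<open>f 0 y\<close> and \<open>f y 0\<close>. Hence the unit of the extension is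
    \<open>(inv e, 0)\<close>, and \<open>a\<close> embeds centrally as
    \<open>(a \<otimes> inv e, 0)\<close>.\<close>
  define e where "e = f 0 0"
  have e [simp]: "e \<in> carrier G" by (simp add: e_def)
  \<comment> \<open>The central extension of \<open>Z\<^sup>2\<close> by \<open>G\<close> classified by \<open>f\<close>.\<close>
  define E where "E = \<lparr>carrier = carrier G \<times> (UNIV :: (int \<times> int) set),
    monoid.mult = (\<lambda>(a, x) (b, y). (a \<otimes> b \<otimes> f x y, x + y)), one = (inv e, 0)\<rparr>"
  have E_carrier: "p \<in> carrier E \<longleftrightarrow> fst p \<in> carrier G" for p
    by (cases p) (simp add: E_def)
  have E_mult [simp]: "(a, x) \<otimes>\<^bsub>E\<^esub> (b, y) = (a \<otimes> b \<otimes> f x y, x + y)" for a b x y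
    by (simp add: E_def)
  have f0: "f 0 y = e" "f y 0 = e" for y
    using cocycle[of 0 y 0] cocycle[of 0 0 y] by (auto simp: e_def)
  have c [simp]: "c \<in> carrier G" by (simp add: c_def)
  have l_central: "(a \<otimes> inv e, 0) \<otimes>\<^bsub>E\<^esub> (b, y) = (a \<otimes> b, y)"
    and r_central: "(b, y) \<otimes>\<^bsub>E\<^esub> (a \<otimes> inv e, 0) = (a \<otimes> b, y)"
    if "a \<in> carrier G" "b \<in> carrier G" for a b y
    using that by (simp_all add: f0 m_ac)
  interpret E: group E
  proof (rule groupI)
    fix p q r assume "p \<in> carrier E" "q \<in> carrier E" "r \<in> carrier E"
    then obtain a x b y d z where "p = (a, x)" "q = (b, y)" "r = (d, z)"
      and "a \<in> carrier G" "b \<in> carrier G" "d \<in> carrier G"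
      by (metis E_carrier prod.collapse)
    moreover have "f x y \<otimes> f (x + y) z = f y z \<otimes> f x (y + z)"
      using cocycle[of y z x] by (simp add: m_comm[of "f x y"])
    moreover have "a \<otimes> b \<otimes> f x y \<otimes> d \<otimes> f (x + y) z = a \<otimes> b \<otimes> d \<otimes> (f x y \<otimes> f (x + y) z)"
      "a \<otimes> (b \<otimes> d \<otimes> f y z) \<otimes> f x (y + z) = a \<otimes> b \<otimes> d \<otimes> (f y z \<otimes> f x (y + z))"
      if "a \<in> carrier G" "b \<in> carrier G" "d \<in> carrier G"
      using that by (simp_all add: m_ac)
    ultimately show "p \<otimes>\<^bsub>E\<^esub> q \<otimes>\<^bsub>E\<^esub> r = p \<otimes>\<^bsub>E\<^esub> (q \<otimes>\<^bsub>E\<^esub> r)"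
      by (simp add: add.assoc)
  next
    fix p assume "p \<in> carrier E"
    then obtain a x where p: "p = (a, x)" "a \<in> carrier G"
      by (metis E_carrier prod.collapse)
    show "\<one>\<^bsub>E\<^esub> \<otimes>\<^bsub>E\<^esub> p = p"
      using l_central[of \<one> a x] p by (simp add: E_def)
    \<comment> \<open>The product of \<open>?q\<close> and \<open>p\<close> picks up the factor
      \<open>f (- x) x\<close>, and its first component must be \<open>inv e\<close>; this
      determines the first entry of \<open>?q\<close>.\<close>
    let ?q = "(inv (a \<otimes> f (- x) x \<otimes> e), - x)"
    have "?q \<otimes>\<^bsub>E\<^esub> p = \<one>\<^bsub>E\<^esub>"
      using p by (simp add: E_def inv_mult m_ac) (simp add: r_inv flip: m_assoc)
    then show "\<exists>q \<in> carrier E. q \<otimes>\<^bsub>E\<^esub> p = \<one>\<^bsub>E\<^esub>"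
      using p by (intro bexI[of _ ?q]) (auto simp: E_carrier)
  qed (auto simp: E_def)
  define j where "j a = (a \<otimes> inv e, 0 :: int \<times> int)" for a
  have j_carrier: "j a \<in> carrier E" if "a \<in> carrier G" for a
    using that by (simp add: j_def E_carrier)
  have "j \<in> hom G E"
    by (rule homI) (auto simp: j_def E_carrier l_central m_assoc simp del: E_mult)
  then interpret j: group_hom G E j by unfold_locales
  define u where "u = (\<one>, (1, 0) :: int \<times> int)"
  define v where "v = (\<one>, (0, 1) :: int \<times> int)"
  have uv_carrier: "u \<in> carrier E" "v \<in> carrier E"
    by (simp_all add: u_def v_def E_carrier)
  have "u \<otimes>\<^bsub>E\<^esub> v = j c \<otimes>\<^bsub>E\<^esub> v \<otimes>\<^bsub>E\<^esub> u"
    by (simp add: u_def v_def j_def l_central del: E_mult) (simp add: c_def m_assoc)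
  moreover have "u \<otimes>\<^bsub>E\<^esub> j c = j c \<otimes>\<^bsub>E\<^esub> u" "v \<otimes>\<^bsub>E\<^esub> j c = j c \<otimes>\<^bsub>E\<^esub> v"
    by (simp_all add: u_def v_def j_def l_central r_central del: E_mult)
  ultimately have swap: "v [^]\<^bsub>E\<^esub> n \<otimes>\<^bsub>E\<^esub> u [^]\<^bsub>E\<^esub> m
      = j (c [^] (- (n * m))) \<otimes>\<^bsub>E\<^esub> u [^]\<^bsub>E\<^esub> m \<otimes>\<^bsub>E\<^esub> v [^]\<^bsub>E\<^esub> n" for m n :: int
    using E.central_commutator_pow[of u v "j c" n m] uv_carrier j_carrier
    by (simp add: j.hom_int_pow del: int_pow_neg)
  define t where "t x = u [^]\<^bsub>E\<^esub> fst x \<otimes>\<^bsub>E\<^esub> v [^]\<^bsub>E\<^esub> snd x" for x :: "int \<times> int"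
  have t_carrier: "t x \<in> carrier E" for x
    using uv_carrier by (simp add: t_def)
  have snd_t: "snd (t x) = x" for x
  proof -
    \<comment> \<open>Both coordinates of the projection to Z^2 are homomorphisms to Z, so they can
      be evaluated on powers of \<open>u\<close> and \<open>v\<close>; thus \<open>t\<close> is a
      section.\<close>
    have "(\<lambda>p. fst (snd p)) \<in> hom E integer_group" "(\<lambda>p. snd (snd p)) \<in> hom E integer_group"
      by (auto simp: hom_def E_def)
    then interpret p1: group_hom E integer_group "\<lambda>p. fst (snd p)"
      + p2: group_hom E integer_group "\<lambda>p. snd (snd p)"
      by (simp_all add: group_hom_def group_hom_axioms_def)
    show ?thesis
      using uv_carrier
      by (simp add: t_def prod_eq_iff p1.hom_int_pow p2.hom_int_pow) (simp add: u_def v_def)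
  qed
  have t_mult: "t x \<otimes>\<^bsub>E\<^esub> t y = j (c [^] (- (snd x * fst y))) \<otimes>\<^bsub>E\<^esub> t (x + y)" for x y
  proof -
    let ?k = "j (c [^] (- (snd x * fst y)))"
    have k: "?k \<in> carrier E" by (simp add: j_carrier)
    have comm: "u [^]\<^bsub>E\<^esub> fst x \<otimes>\<^bsub>E\<^esub> ?k = ?k \<otimes>\<^bsub>E\<^esub> u [^]\<^bsub>E\<^esub> fst x"
    proof -
      obtain b z where "u [^]\<^bsub>E\<^esub> fst x = (b, z)" "b \<in> carrier G"
        using uv_carrier E.int_pow_closed E_carrier by (metis prod.collapse)
      then show ?thesis by (simp add: j_def l_central r_central del: E_mult)
    qed
    \<comment> \<open>Only the two middle powers are out of order. \<open>swap\<close> exchanges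
      them at the cost of the central factor \<open>?k\<close>, which then moves to the
      front.\<close>
    have "t x \<otimes>\<^bsub>E\<^esub> t y = u [^]\<^bsub>E\<^esub> fst x \<otimes>\<^bsub>E\<^esub>
        (v [^]\<^bsub>E\<^esub> snd x \<otimes>\<^bsub>E\<^esub> u [^]\<^bsub>E\<^esub> fst y) \<otimes>\<^bsub>E\<^esub> v [^]\<^bsub>E\<^esub> snd y"
      using uv_carrier by (simp add: t_def E.m_assoc)
    also have "\<dots> = u [^]\<^bsub>E\<^esub> fst x \<otimes>\<^bsub>E\<^esub> ?k \<otimes>\<^bsub>E\<^esub>
        u [^]\<^bsub>E\<^esub> fst y \<otimes>\<^bsub>E\<^esub> v [^]\<^bsub>E\<^esub> snd x \<otimes>\<^bsub>E\<^esub> v [^]\<^bsub>E\<^esub> snd y"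
      using uv_carrier k by (simp only: swap) (simp add: E.m_assoc)
    also have "\<dots> = ?k \<otimes>\<^bsub>E\<^esub> (u [^]\<^bsub>E\<^esub> fst x \<otimes>\<^bsub>E\<^esub> u [^]\<^bsub>E\<^esub> fst y)
        \<otimes>\<^bsub>E\<^esub> (v [^]\<^bsub>E\<^esub> snd x \<otimes>\<^bsub>E\<^esub> v [^]\<^bsub>E\<^esub> snd y)"
      unfolding comm using uv_carrier k by (simp add: E.m_assoc)
    also have "\<dots> = ?k \<otimes>\<^bsub>E\<^esub> t (x + y)"
      using uv_carrier k by (simp add: t_def E.int_pow_mult E.m_assoc)
    finally show ?thesis .
  qed
  define s where "s x = fst (t x)" for x
  have s_carrier: "s x \<in> carrier G" for x
    using t_carrier[of x] by (simp add: s_def E_carrier)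
  have t_eq: "t x = (s x, x)" for x
    using snd_t[of x] by (simp add: s_def prod_eq_iff)
  \<comment> \<open>This is \<open>t_mult\<close> read in the first component, where the
    multiplication of \<open>E\<close> contributes \<open>f x y\<close>.\<close>
  have "f x y \<otimes> s x \<otimes> s y = c [^] (- (snd x * fst y)) \<otimes> s (x + y)" for x y
    using t_mult[of x y] s_carrier
    by (simp add: t_eq j_def l_central del: E_mult int_pow_neg) (simp add: m_ac)
  with s_carrier show thesis by (rule that)
qed

section \<open>The bar complex\<close>

abbreviation bar_chains :: "nat \<Rightarrow> ('a, 'm) monoid_scheme \<Rightarrow> ('a list \<Rightarrow>\<^sub>0 int) set" where
  "bar_chains n G \<equiv> carrier (bar_chain_group n G)"

abbreviation chain_map :: "('a \<Rightarrow> 'b) \<Rightarrow> ('a list \<Rightarrow>\<^sub>0 int) \<Rightarrow> ('b list \<Rightarrow>\<^sub>0 int)" where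
  "chain_map f \<equiv> frag_extend (\<lambda>xs. frag_of (map f xs))"

text \<open>A coset depends only on the multiplication, here addition of chains. So this set makes
  sense for any chain, and is also its class in the chains modulo boundaries.\<close>

abbreviation bar_class :: "nat \<Rightarrow> ('a, 'm) monoid_scheme \<Rightarrow> ('a list \<Rightarrow>\<^sub>0 int) \<Rightarrow> ('a list \<Rightarrow>\<^sub>0 int) set" where
  "bar_class n G c \<equiv> bar_boundaries n G #>\<^bsub>bar_cycle_group n G\<^esub> c"

section \<open>Arithmetic of bar chains\<close>

lemma comm_group_bar_chain_group: "comm_group (bar_chain_group n G)"
  by (simp add: bar_chain_group_def abelian_free_Abelian_group)

lemma bar_chains_iff:
  "c \<in> bar_chains n G \<longleftrightarrow> Poly_Mapping.keys c \<subseteq> {xs. length xs = n \<and> set xs \<subseteq> carrier G}"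
  by (simp add: bar_chain_group_def)

lemma mult_bar_chain_group [simp]: "c \<otimes>\<^bsub>bar_chain_group n G\<^esub> d = c + d"
  by (simp add: bar_chain_group_def)

lemma one_bar_chain_group [simp]: "\<one>\<^bsub>bar_chain_group n G\<^esub> = 0"
  by (simp add: bar_chain_group_def)

lemma frag_of_in_bar_chains [simp]:
  "frag_of xs \<in> bar_chains n G \<longleftrightarrow> length xs = n \<and> set xs \<subseteq> carrier G"
  by (simp add: bar_chains_iff keys_frag_of)

lemma zero_in_bar_chains [simp]: "0 \<in> bar_chains n G"
  by (simp add: bar_chains_iff)

lemma diff_in_bar_chains: "\<lbrakk>c \<in> bar_chains n G; d \<in> bar_chains n G\<rbrakk> \<Longrightarrow> c - d \<in> bar_chains n G"
  unfolding bar_chains_iff using keys_diff[of c d] by blast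

lemma add_in_bar_chains: "\<lbrakk>c \<in> bar_chains n G; d \<in> bar_chains n G\<rbrakk> \<Longrightarrow> c + d \<in> bar_chains n G"
  unfolding bar_chains_iff using Poly_Mapping.keys_add[of c d] by blast

lemma cmul_in_bar_chains: "c \<in> bar_chains n G \<Longrightarrow> frag_cmul k c \<in> bar_chains n G"
  using keys_cmul[of k c] by (auto simp: bar_chains_iff)

lemma inv_bar_chain_group: "c \<in> bar_chains n G \<Longrightarrow> inv\<^bsub>bar_chain_group n G\<^esub> c = - c"
  by (simp add: bar_chain_group_def)

lemma int_pow_bar_chain_group:
  "c \<in> bar_chains n G \<Longrightarrow> c [^]\<^bsub>bar_chain_group n G\<^esub> (k :: int) = frag_cmul k c"
  by (simp add: bar_chain_group_def)

lemma frag_extend_in_bar_chains: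
  assumes "c \<in> bar_chains m G"
    and "\<And>xs. \<lbrakk>length xs = m; set xs \<subseteq> carrier G\<rbrakk> \<Longrightarrow> h xs \<in> bar_chains n H"
  shows "frag_extend h c \<in> bar_chains n H"
  using assms(1)[unfolded bar_chains_iff]
  by (induction c rule: frag_induction) (auto simp: assms(2) frag_extend_diff diff_in_bar_chains)

section \<open>The boundary map and its naturality\<close>

lemma bar_boundary_diff: "bar_boundary G (c - d) = bar_boundary G c - bar_boundary G d"
  by (simp add: bar_boundary_def frag_extend_diff)

lemma bar_boundary_add: "bar_boundary G (c + d) = bar_boundary G c + bar_boundary G d"
  by (simp add: bar_boundary_def frag_extend_add)

lemma bar_boundary_zero [simp]: "bar_boundary G 0 = 0"
  by (simp add: bar_boundary_def)

lemma bar_boundary_2 [simp]: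
  "bar_boundary G (frag_of [x, y]) = frag_of [y] - frag_of [x \<otimes>\<^bsub>G\<^esub> y] + frag_of [x]"
  by (simp add: bar_boundary_def bar_face_def numeral_2_eq_2)

lemma bar_boundary_3 [simp]:
  "bar_boundary G (frag_of [x, y, z]) =
     frag_of [y, z] - frag_of [x \<otimes>\<^bsub>G\<^esub> y, z] + frag_of [x, y \<otimes>\<^bsub>G\<^esub> z] - frag_of [x, y]"
  by (simp add: bar_boundary_def bar_face_def eval_nat_numeral)

lemma bar_face_closed:
  assumes "group G" "length xs = Suc n" "set xs \<subseteq> carrier G" "i \<le> Suc n"
  shows "length (bar_face G i xs) = n" "set (bar_face G i xs) \<subseteq> carrier G"
proof -
  interpret group G by fact
  show "length (bar_face G i xs) = n"
    using assms by (auto simp: bar_face_def)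
  consider "i = 0" | "i = Suc n" | "0 < i" "i < Suc n" using assms by linarith
  then show "set (bar_face G i xs) \<subseteq> carrier G"
  proof cases
    case 1
    then show ?thesis using assms by (cases xs) (auto simp: bar_face_def)
  next
    case 2
    then show ?thesis using assms by (auto simp: bar_face_def dest: in_set_butlastD)
  next
    case 3
    then have "xs ! (i - 1) \<in> carrier G" "xs ! i \<in> carrier G"
      using assms by (auto intro!: subsetD[OF assms(3)] nth_mem)
    then show ?thesis
      using 3 assms by (auto simp: bar_face_def dest!: in_set_takeD in_set_dropD)
  qed
qed

lemma bar_face_map:
  assumes "f \<in> hom G H" "set xs \<subseteq> carrier G" "i \<le> length xs" "xs \<noteq> []"
  shows "bar_face H i (map f xs) = map f (bar_face G i xs)"
proof -
  have "f (xs ! (i - 1)) \<otimes>\<^bsub>H\<^esub> f (xs ! i) = f (xs ! (i - 1) \<otimes>\<^bsub>G\<^esub> xs ! i)" if "0 < i" "i < length xs"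
    using assms that by (intro hom_mult[symmetric]) (auto intro!: subsetD[OF assms(2)] nth_mem)
  then show ?thesis
    using assms by (auto simp: bar_face_def map_tl map_butlast take_map drop_map)
qed

lemma bar_boundary_closed:
  assumes "group G" "c \<in> bar_chains (Suc n) G"
  shows "bar_boundary G c \<in> bar_chains n G"
  unfolding bar_boundary_def
proof (rule frag_extend_in_bar_chains[OF assms(2)])
  fix xs assume xs: "length xs = Suc n" "set xs \<subseteq> carrier G"
  \<comment> \<open>Arbitrary sets \<open>I\<close> of face indices allow induction on finite sets;
    the full index set is then a special case.\<close>
  have "(\<Sum>i\<in>I. frag_cmul ((-1) ^ i) (frag_of (bar_face G i xs))) \<in> bar_chains n G"
    if "finite I" "I \<subseteq> {..Suc n}" for I
    using that
    by (induction I rule: finite_induct)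
      (use bar_face_closed[OF assms(1) xs] in \<open>auto intro!: add_in_bar_chains cmul_in_bar_chains\<close>)
  from this[of "{..Suc n}"]
  show "(if xs = [] then 0 else \<Sum>i\<le>length xs. frag_cmul ((- 1) ^ i) (frag_of (bar_face G i xs)))
      \<in> bar_chains n G"
    using xs by (auto simp del: sum.atMost_Suc)
qed

lemma chain_map_closed:
  assumes "f \<in> hom G H" "c \<in> bar_chains n G"
  shows "chain_map f c \<in> bar_chains n H"
  using assms(2)
  by (rule frag_extend_in_bar_chains) (use assms(1) in \<open>auto simp: hom_def\<close>)

lemma bar_boundary_chain_map:
  assumes "f \<in> hom G H" "c \<in> bar_chains n G"
  shows "bar_boundary H (chain_map f c) = chain_map f (bar_boundary G c)"
  using assms(2)[unfolded bar_chains_iff]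
proof (induction c rule: frag_induction)
  case (one xs)
  then have "bar_face H i (map f xs) = map f (bar_face G i xs)" if "i \<le> length xs" "xs \<noteq> []" for i
    using bar_face_map[OF assms(1)] that by auto
  then show ?case
    by (simp add: bar_boundary_def frag_extend_sum frag_extend_cmul)
qed (simp_all add: bar_boundary_diff frag_extend_diff)

section \<open>Boundaries, cycles and homology classes\<close>

lemma subgroup_bar_boundaries:
  assumes "group G"
  shows "subgroup (bar_boundaries n G) (bar_chain_group n G)"
proof -
  interpret C: comm_group "bar_chain_group (Suc n) G" by (rule comm_group_bar_chain_group)
  interpret D: comm_group "bar_chain_group n G" by (rule comm_group_bar_chain_group)
  interpret group_hom "bar_chain_group (Suc n) G" "bar_chain_group n G" "bar_boundary G"
    by unfold_locales (simp add: hom_def bar_boundary_add bar_boundary_closed[OF assms])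
  show ?thesis unfolding bar_boundaries_def by (rule img_is_subgroup)
qed

lemma bar_boundaries_add:
  "\<lbrakk>group G; b \<in> bar_boundaries n G; c \<in> bar_boundaries n G\<rbrakk> \<Longrightarrow> b + c \<in> bar_boundaries n G"
  using subgroup.m_closed[OF subgroup_bar_boundaries] by fastforce

lemma bar_boundaries_diff:
  assumes "b \<in> bar_boundaries n G" "c \<in> bar_boundaries n G"
  shows "b - c \<in> bar_boundaries n G"
proof -
  from assms obtain b' c' where "b' \<in> bar_chains (Suc n) G" "c' \<in> bar_chains (Suc n) G"
    "b = bar_boundary G b'" "c = bar_boundary G c'"
    by (auto simp: bar_boundaries_def)
  then show ?thesis
    by (metis bar_boundaries_def bar_boundary_diff diff_in_bar_chains imageI)
qed

lemma bar_boundary_in_bar_boundaries: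
  "c \<in> bar_chains (Suc n) G \<Longrightarrow> bar_boundary G c \<in> bar_boundaries n G"
  by (simp add: bar_boundaries_def)

lemma subgroup_cycles:
  assumes "group G"
  shows "subgroup {c \<in> bar_chains n G. bar_boundary G c = 0} (bar_chain_group n G)"
proof -
  interpret comm_group "bar_chain_group n G" by (rule comm_group_bar_chain_group)
  have "- c \<in> bar_chains n G" if "c \<in> bar_chains n G" for c
    using that inv_closed inv_bar_chain_group by metis
  moreover have "bar_boundary G (- c) = - bar_boundary G c" for c
    using bar_boundary_diff[of G 0 c] by simp
  ultimately show ?thesis
    by (intro subgroupI) (auto simp: inv_bar_chain_group add_in_bar_chains bar_boundary_add)
qed

lemma carrier_bar_cycle_group:
  "group G \<Longrightarrow> carrier (bar_cycle_group n G) = {c \<in> bar_chains n G. bar_boundary G c = 0}"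
  unfolding bar_cycle_group_def
  by (rule subgroup.carrier_subgroup_generated_subgroup[OF subgroup_cycles])

lemma mult_bar_cycle_group [simp]: "c \<otimes>\<^bsub>bar_cycle_group n G\<^esub> d = c + d"
  by (simp add: bar_cycle_group_def)

lemma bar_class_iff: "d \<in> bar_class n G c \<longleftrightarrow> d - c \<in> bar_boundaries n G"
  by (auto simp: r_coset_def) (metis diff_add_cancel)

lemma bar_class_self: "c \<in> bar_class n G c"
  using bar_boundary_in_bar_boundaries[of 0 n G] by (simp add: bar_class_iff)

lemma bar_class_eqI:
  assumes "group G" "c - d \<in> bar_boundaries n G"
  shows "bar_class n G c = bar_class n G d"
proof -
  have "x - d \<in> bar_boundaries n G" if "x - c \<in> bar_boundaries n G" for x
    using bar_boundaries_add[OF assms(1) that assms(2)] by simp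
  moreover have "x - c \<in> bar_boundaries n G" if "x - d \<in> bar_boundaries n G" for x
    using bar_boundaries_diff[OF that assms(2)] by simp
  ultimately show ?thesis
    by (auto simp: bar_class_iff)
qed

lemma carrier_group_homology:
  assumes "group G"
  shows "carrier (group_homology n G) =
    bar_class n G ` {c \<in> bar_chains n G. bar_boundary G c = 0}"
  using assms
  by (auto simp: group_homology_def FactGroup_def RCOSETS_def carrier_bar_cycle_group)

text \<open>Representatives of a class differ by a boundary, and the chain map sends boundaries to
  boundaries; so \<open>the_elem\<close> is applied to a singleton.\<close>

lemma group_homology_map_bar_class:
  assumes "group G" "group H" "f \<in> hom G H"
  shows "group_homology_map n H f (bar_class n G c) = bar_class n H (chain_map f c)"
proof -
  have "bar_class n H (chain_map f d) = bar_class n H (chain_map f c)"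
    if "d \<in> bar_class n G c" for d
  proof (rule bar_class_eqI[OF assms(2)])
    have "d - c \<in> bar_boundaries n G"
      using that by (simp only: bar_class_iff)
    then obtain b where "b \<in> bar_chains (Suc n) G" "d - c = bar_boundary G b"
      by (auto simp: bar_boundaries_def)
    then show "chain_map f d - chain_map f c \<in> bar_boundaries n H"
      by (metis assms(3) bar_boundary_chain_map bar_boundary_in_bar_boundaries chain_map_closed
          frag_extend_diff)
  qed
  then have "(\<lambda>d. bar_class n H (chain_map f d)) ` bar_class n G c = {bar_class n H (chain_map f c)}"
    using bar_class_self by blast
  then show ?thesis by (simp add: group_homology_map_def)
qed

text \<open>The identity d d = 0 from degree 3 to degree 1: on a symbol \<open>[x|y|z]\<close> all
  terms cancel once \<open>(x y) z\<close> and \<open>x (y z)\<close> are identified.\<close>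

lemma bar_boundaries_2_subset_cycles:
  assumes "group G" "c \<in> bar_boundaries 2 G"
  shows "c \<in> bar_chains 2 G" "bar_boundary G c = 0"
proof -
  interpret group G by fact
  obtain b where b: "b \<in> bar_chains 3 G" and c: "c = bar_boundary G b"
    using assms(2) by (auto simp: bar_boundaries_def eval_nat_numeral)
  show "c \<in> bar_chains 2 G"
    using bar_boundary_closed[OF assms(1)] b by (simp add: c eval_nat_numeral)
  have "bar_boundary G (bar_boundary G b) = 0"
    using b[unfolded bar_chains_iff]
  proof (induction b rule: frag_induction)
    case (one xs)
    then obtain x y z where "xs = [x, y, z]" "x \<in> carrier G" "y \<in> carrier G" "z \<in> carrier G"
      by (auto simp: numeral_3_eq_3 length_Suc_conv)
    then show ?case by (simp add: bar_boundary_diff bar_boundary_add m_assoc)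
  qed (simp_all add: bar_boundary_diff)
  then show "bar_boundary G c = 0" by (simp add: c)
qed

lemma group_group_homology_2:
  assumes "group G"
  shows "bar_boundaries 2 G \<lhd> bar_cycle_group 2 G" "group (group_homology 2 G)"
proof -
  interpret C: comm_group "bar_chain_group 2 G" by (rule comm_group_bar_chain_group)
  interpret Z: comm_group "bar_cycle_group 2 G"
    unfolding bar_cycle_group_def by (rule C.abelian_subgroup_generated[OF C.comm_group_axioms])
  have "subgroup (bar_boundaries 2 G) (bar_cycle_group 2 G)"
    unfolding bar_cycle_group_def
    by (rule C.subgroup_of_subgroup_generated)
       (use subgroup_bar_boundaries[OF assms, of 2] bar_boundaries_2_subset_cycles[OF assms] in auto)
  then show "bar_boundaries 2 G \<lhd> bar_cycle_group 2 G"
    by (rule Z.subgroup_imp_normal)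
  then show "group (group_homology 2 G)"
    unfolding group_homology_def by (rule normal.factorgroup_is_group)
qed

lemma int_pow_bar_class:
  assumes "group G" "c \<in> bar_chains 2 G" "bar_boundary G c = 0"
  shows "bar_class 2 G c [^]\<^bsub>group_homology 2 G\<^esub> (k :: int) = bar_class 2 G (frag_cmul k c)"
proof -
  interpret C: comm_group "bar_chain_group 2 G" by (rule comm_group_bar_chain_group)
  have "c \<in> carrier (bar_cycle_group 2 G)"
    using assms by (simp add: carrier_bar_cycle_group)
  then have "bar_class 2 G c [^]\<^bsub>group_homology 2 G\<^esub> k = bar_class 2 G (c [^]\<^bsub>bar_cycle_group 2 G\<^esub> k)"
    unfolding group_homology_def
    by (rule normal.FactGroup_int_pow[OF group_group_homology_2(1)[OF assms(1)]])
  moreover have "c [^]\<^bsub>bar_cycle_group 2 G\<^esub> k = frag_cmul k c"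
    using C.int_pow_subgroup_generated assms
    by (metis (no_types, lifting) \<open>c \<in> carrier (bar_cycle_group 2 G)\<close> bar_cycle_group_def int_pow_bar_chain_group)
  ultimately show ?thesis by simp
qed

section \<open>The second homology of the free abelian group of rank two\<close>

lemma group_Z_squared: "group Z_squared"
  by (simp add: DirProd_group)

lemma mult_Z_squared [simp]: "x \<otimes>\<^bsub>Z_squared\<^esub> y = x + y"
  by (simp add: prod_eq_iff mult_DirProd')

lemma int_pow_Z_squared: "(a, b) [^]\<^bsub>Z_squared\<^esub> (k :: int) = (k * a, k * b)"
proof -
  interpret fst: group_hom Z_squared integer_group fst
    using group_Z_squared by (simp add: group_hom_def group_hom_axioms_def hom_def)
  interpret snd: group_hom Z_squared integer_group snd
    using group_Z_squared by (simp add: group_hom_def group_hom_axioms_def hom_def)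
  show ?thesis
    by (simp add: prod_eq_iff fst.hom_int_pow snd.hom_int_pow)
qed

lemma generate_Z_squared: "generate Z_squared {(1, 0), (0, 1)} = UNIV"
proof -
  interpret group Z_squared by (rule group_Z_squared)
  interpret S: subgroup "generate Z_squared {(1, 0), (0, 1)}" Z_squared
    by (rule generate_is_subgroup) simp
  have "(m, n) \<in> generate Z_squared {(1, 0), (0, 1)}" for m n
  proof -
    have "(1, 0) [^]\<^bsub>Z_squared\<^esub> m \<otimes>\<^bsub>Z_squared\<^esub> (0, 1) [^]\<^bsub>Z_squared\<^esub> n \<in> generate Z_squared {(1, 0), (0, 1)}"
      by (intro S.m_closed subgroup_int_pow_closed[OF S.subgroup_axioms] generate.incl) simp_all
    then show ?thesis by (simp add: int_pow_Z_squared)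
  qed
  then show ?thesis by auto
qed

text \<open>The square with sides \<open>a\<close> and \<open>b\<close>, cut by its diagonal into
  two triangles. It closes up to a torus when \<open>a\<close> and \<open>b\<close> commute.\<close>

definition torus_cycle :: "'a \<Rightarrow> 'a \<Rightarrow> ('a list \<Rightarrow>\<^sub>0 int)" where
  "torus_cycle a b = frag_of [a, b] - frag_of [b, a]"

text \<open>The map sending \<open>(x, y)\<close> to the class of \<open>[x|y]\<close> modulo
  boundaries is a cocycle, by the boundary of \<open>[x|y|z]\<close>.
  \<open>cocycle_Z_squared\<close> makes it a multiple of the torus cycle up to the coboundary of a
  function \<open>r\<close>, and the contribution of \<open>r\<close> vanishes on cycles.\<close>

lemma bar_class_Z_squared_cycle:
  assumes "c \<in> bar_chains 2 Z_squared" "bar_boundary Z_squared c = 0"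
  obtains k where "bar_class 2 Z_squared c =
    bar_class 2 Z_squared (frag_cmul k (torus_cycle (1, 0) (0, 1)))"
proof -
  let ?C = "bar_chain_group 2 Z_squared" and ?B = "bar_boundaries 2 Z_squared"
  let ?\<tau> = "torus_cycle (1, 0) (0, 1) :: (int \<times> int) list \<Rightarrow>\<^sub>0 int"
  interpret C: comm_group ?C by (rule comm_group_bar_chain_group)
  have sub: "subgroup ?B ?C" by (rule subgroup_bar_boundaries[OF group_Z_squared])
  interpret B: normal ?B ?C by (rule C.subgroup_imp_normal[OF sub])
  interpret M: comm_group "?C Mod ?B" by (rule C.abelian_FactGroup[OF sub])
  \<comment> \<open>Single symbols are not cycles in general, so the coefficient group consists of
    all 2-chains modulo boundaries.\<close>
  define q where "q c = ?B #>\<^bsub>?C\<^esub> c" for c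
  have q_class: "q c = bar_class 2 Z_squared c" for c
    by (simp add: q_def r_coset_def)
  have q_eq: "c - d \<in> ?B" if "q c = q d" for c d
    using that bar_class_self[of c] bar_class_iff q_class by metis
  have "q \<in> hom ?C (?C Mod ?B)"
    unfolding q_def by (rule B.r_coset_hom_Mod)
  then interpret q: group_hom ?C "?C Mod ?B" q by unfold_locales
  have q_add: "q c \<otimes>\<^bsub>?C Mod ?B\<^esub> q d = q (c + d)" if "c \<in> carrier ?C" "d \<in> carrier ?C" for c d
    using q.hom_mult[OF that] by simp
  have \<tau>: "?\<tau> \<in> carrier ?C"
    by (simp add: torus_cycle_def diff_in_bar_chains)
  define f where "f x y = q (frag_of [x, y])" for x y :: "int \<times> int"
  have f: "f x y \<in> carrier (?C Mod ?B)" for x y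
    by (simp add: f_def)
  have cocycle: "f y z \<otimes>\<^bsub>?C Mod ?B\<^esub> f x (y + z) = f (x + y) z \<otimes>\<^bsub>?C Mod ?B\<^esub> f x y" for x y z
  proof -
    have "bar_boundary Z_squared (frag_of [x, y, z]) \<in> ?B"
      by (rule bar_boundary_in_bar_boundaries) simp
    then have "(frag_of [y, z] + frag_of [x, y + z]) - (frag_of [x + y, z] + frag_of [x, y]) \<in> ?B"
      by (simp add: algebra_simps)
    then have "q (frag_of [y, z] + frag_of [x, y + z]) = q (frag_of [x + y, z] + frag_of [x, y])"
      by (simp add: q_class bar_class_eqI[OF group_Z_squared])
    then show ?thesis
      by (simp add: f_def q_add del: mult_FactGroup)
  qed
  have \<tau>_eq: "q ?\<tau> = f (1, 0) (0, 1) \<otimes>\<^bsub>?C Mod ?B\<^esub> inv\<^bsub>?C Mod ?B\<^esub> f (0, 1) (1, 0)"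
  proof -
    have "q ?\<tau> \<otimes>\<^bsub>?C Mod ?B\<^esub> f (0, 1) (1, 0) = f (1, 0) (0, 1)"
      using \<tau> by (simp add: f_def q_add del: mult_FactGroup) (simp add: torus_cycle_def)
    then show ?thesis
      using \<tau> f by (simp add: M.inv_solve_right del: mult_FactGroup)
  qed
  obtain s where s: "\<And>x. s x \<in> carrier (?C Mod ?B)"
    and fs: "\<And>x y. f x y \<otimes>\<^bsub>?C Mod ?B\<^esub> s x \<otimes>\<^bsub>?C Mod ?B\<^esub> s y
      = q ?\<tau> [^]\<^bsub>?C Mod ?B\<^esub> (- (snd x * fst y)) \<otimes>\<^bsub>?C Mod ?B\<^esub> s (x + y)"
    using M.cocycle_Z_squared[of f, OF f cocycle] unfolding \<tau>_eq by metis
  have "\<exists>c. c \<in> carrier ?C \<and> q c = s x" for x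
    using s[of x] by (auto simp: FactGroup_def RCOSETS_def q_def)
  then obtain r where r: "\<And>x. r x \<in> carrier ?C" "\<And>x. q (r x) = s x" by metis
  \<comment> \<open>The linear extension of \<open>r\<close> to 1-chains, whose symbols are
    one-letter lists. On the boundary of \<open>[x|y]\<close> it gives
    \<open>r y - r (x + y) + r x\<close>, the coboundary of \<open>r\<close>.\<close>
  define S :: "((int \<times> int) list \<Rightarrow>\<^sub>0 int) \<Rightarrow> ((int \<times> int) list \<Rightarrow>\<^sub>0 int)"
    where "S = frag_extend (\<lambda>xs. r (hd xs))"
  \<comment> \<open>The claim holds for every 2-chain, which permits induction on symbols. For a
    cycle the term with \<open>S\<close> is zero.\<close>
  have "\<exists>k. c + S (bar_boundary Z_squared c) - frag_cmul k ?\<tau> \<in> ?B"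
    using assms(1)[unfolded bar_chains_iff]
  proof (induction c rule: frag_induction)
    case zero
    then show ?case
      using bar_boundary_in_bar_boundaries[of 0 2 Z_squared]
      by (intro exI[of _ 0]) (simp add: S_def)
  next
    case (one xs)
    then obtain x y where xs: "xs = [x, y]"
      by (auto simp: numeral_2_eq_2 length_Suc_conv)
    define k where "k = - (snd x * fst y)"
    have fr: "frag_of [x, y] \<in> carrier ?C" "frag_cmul k ?\<tau> \<in> carrier ?C"
      using \<tau> by (simp_all add: cmul_in_bar_chains)
    have "q ?\<tau> [^]\<^bsub>?C Mod ?B\<^esub> k = q (frag_cmul k ?\<tau>)"
      using q.hom_int_pow[OF \<tau>, of k] int_pow_bar_chain_group[OF \<tau>, of k] by simp
    then have "q (frag_of [x, y]) \<otimes>\<^bsub>?C Mod ?B\<^esub> q (r x) \<otimes>\<^bsub>?C Mod ?B\<^esub> q (r y) =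
        q (frag_cmul k ?\<tau>) \<otimes>\<^bsub>?C Mod ?B\<^esub> q (r (x + y))"
      using fs[of x y] by (simp only: r f_def k_def)
    then have "q (frag_of [x, y] + r x + r y) = q (frag_cmul k ?\<tau> + r (x + y))"
      by (simp only: q_add fr r(1) add_in_bar_chains)
    then have "(frag_of [x, y] + r x + r y) - (frag_cmul k ?\<tau> + r (x + y)) \<in> ?B"
      by (rule q_eq)
    moreover have "frag_of xs + S (bar_boundary Z_squared (frag_of xs)) - frag_cmul k ?\<tau> =
        (frag_of [x, y] + r x + r y) - (frag_cmul k ?\<tau> + r (x + y))"
      by (simp add: xs S_def frag_extend_add frag_extend_diff algebra_simps)
    ultimately show ?case by metis
  next
    case (diff a b)
    then obtain k l where "a + S (bar_boundary Z_squared a) - frag_cmul k ?\<tau> \<in> ?B"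
      "b + S (bar_boundary Z_squared b) - frag_cmul l ?\<tau> \<in> ?B" by blast
    from bar_boundaries_diff[OF this] show ?case
      by (intro exI[of _ "k - l"])
        (simp add: S_def frag_extend_diff bar_boundary_diff frag_cmul_diff_distrib algebra_simps)
  qed
  then obtain k where "c - frag_cmul k ?\<tau> \<in> ?B"
    using assms(2) by (auto simp: S_def)
  then show thesis
    using that bar_class_eqI[OF group_Z_squared] by blast
qed

lemma torus_cycle_closed:
  assumes "a \<in> carrier G" "b \<in> carrier G" "a \<otimes>\<^bsub>G\<^esub> b = b \<otimes>\<^bsub>G\<^esub> a"
  shows "torus_cycle a b \<in> bar_chains 2 G" "bar_boundary G (torus_cycle a b) = 0"
  using assms by (simp_all add: torus_cycle_def diff_in_bar_chains bar_boundary_diff)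

lemma group_homology_2_Z_squared_generator:
  defines "\<xi> \<equiv> bar_class 2 Z_squared (torus_cycle (1, 0) (0, 1))"
  shows "\<xi> \<in> carrier (group_homology 2 Z_squared)"
    "generate (group_homology 2 Z_squared) {\<xi>} = carrier (group_homology 2 Z_squared)"
proof -
  let ?\<tau> = "torus_cycle (1, 0) (0, 1) :: (int \<times> int) list \<Rightarrow>\<^sub>0 int"
  interpret H: group "group_homology 2 Z_squared"
    by (rule group_group_homology_2[OF group_Z_squared])
  have \<tau>: "?\<tau> \<in> bar_chains 2 Z_squared" "bar_boundary Z_squared ?\<tau> = 0"
    by (rule torus_cycle_closed; simp)+
  then show \<xi>: "\<xi> \<in> carrier (group_homology 2 Z_squared)"
    by (simp add: carrier_group_homology[OF group_Z_squared] \<xi>_def)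
  show "generate (group_homology 2 Z_squared) {\<xi>} = carrier (group_homology 2 Z_squared)"
  proof
    show "generate (group_homology 2 Z_squared) {\<xi>} \<subseteq> carrier (group_homology 2 Z_squared)"
      using \<xi> by (simp add: H.generate_incl)
    show "carrier (group_homology 2 Z_squared) \<subseteq> generate (group_homology 2 Z_squared) {\<xi>}"
    proof
      fix \<eta> assume "\<eta> \<in> carrier (group_homology 2 Z_squared)"
      then obtain c where c: "c \<in> bar_chains 2 Z_squared" "bar_boundary Z_squared c = 0"
        and \<eta>: "\<eta> = bar_class 2 Z_squared c"
        by (auto simp: carrier_group_homology[OF group_Z_squared])
      obtain k where "\<eta> = bar_class 2 Z_squared (frag_cmul k ?\<tau>)"
        using bar_class_Z_squared_cycle[OF c] \<eta> by metis
      then have "\<eta> = \<xi> [^]\<^bsub>group_homology 2 Z_squared\<^esub> k"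
        using int_pow_bar_class[OF group_Z_squared \<tau>] by (simp add: \<xi>_def)
      then show "\<eta> \<in> generate (group_homology 2 Z_squared) {\<xi>}"
        using H.generate_pow[OF \<xi>] by auto
    qed
  qed
qed

text \<open>By naturality: the chain map of \<open>g\<close> takes the torus cycle of the standard
  generators to that of \<open>a\<close> and \<open>b\<close>.\<close>

lemma is_kappa_torus_cycle:
  assumes "group G" "g \<in> hom Z_squared G" "g (1, 0) = a" "g (0, 1) = b"
  shows "is_kappa G a b (bar_class 2 G (torus_cycle a b))"
proof -
  have "bar_class 2 G (torus_cycle a b) =
      group_homology_map 2 G g (bar_class 2 Z_squared (torus_cycle (1, 0) (0, 1)))"
    unfolding group_homology_map_bar_class[OF group_Z_squared assms(1,2)]
    by (simp add: torus_cycle_def frag_extend_diff assms(3,4))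
  then show ?thesis
    unfolding is_kappa_def using assms(2-4) group_homology_2_Z_squared_generator by blast
qed

text \<open>The pairs \<open>(a, b)\<close> and \<open>(x, y)\<close> have the same commutator
  \<open>z\<close>, so their punctured tori glue to a closed surface. Under \<open>q\<close> the
  half belonging to \<open>(x, y)\<close> collapses.\<close>

lemma torus_class_in_image:
  assumes "group G" "group G'" "q \<in> hom G' G"
    and car: "a \<in> carrier G'" "b \<in> carrier G'" "x \<in> carrier G'" "y \<in> carrier G'" "z \<in> carrier G'"
    and ker: "q x = \<one>\<^bsub>G\<^esub>" "q y = \<one>\<^bsub>G\<^esub>"
    and ab: "a \<otimes>\<^bsub>G'\<^esub> b = z \<otimes>\<^bsub>G'\<^esub> (b \<otimes>\<^bsub>G'\<^esub> a)"
    and xy: "x \<otimes>\<^bsub>G'\<^esub> y = z \<otimes>\<^bsub>G'\<^esub> (y \<otimes>\<^bsub>G'\<^esub> x)"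
  shows "bar_class 2 G (torus_cycle (q a) (q b))
    \<in> group_homology_map 2 G q ` carrier (group_homology 2 G')"
proof -
  interpret G: group G by fact
  interpret G': group G' by fact
  interpret q: group_hom G' G q
    using assms(3) by unfold_locales
  \<comment> \<open>If \<open>u v = z v u\<close> then \<open>[u|v] - [v|u] - [z|vu]\<close> has boundary \<open>-[z]\<close>, whatever \<open>u\<close> and \<open>v\<close> are;
    so two such chains with the same \<open>z\<close> differ by a cycle.\<close>
  define p where "p u v = torus_cycle u v - frag_of [z, v \<otimes>\<^bsub>G'\<^esub> u]" for u v
  have p_closed: "p u v \<in> bar_chains 2 G'" if "u \<in> carrier G'" "v \<in> carrier G'" for u v
    using that car by (simp add: p_def torus_cycle_def diff_in_bar_chains)
  have p_boundary: "bar_boundary G' (p u v) = - frag_of [z]" if "u \<otimes>\<^bsub>G'\<^esub> v = z \<otimes>\<^bsub>G'\<^esub> (v \<otimes>\<^bsub>G'\<^esub> u)" for u v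
    using that by (simp add: p_def torus_cycle_def bar_boundary_diff)
  let ?c = "p a b - p x y"
  have c: "?c \<in> bar_chains 2 G'" "bar_boundary G' ?c = 0"
    using car ab xy by (simp_all add: diff_in_bar_chains p_closed p_boundary bar_boundary_diff)
  \<comment> \<open>The product \<open>z y x\<close> equals \<open>x y\<close>, which
    \<open>q\<close> kills; as \<open>q\<close> also kills \<open>x\<close> and \<open>y\<close>, it
    kills \<open>z\<close>.\<close>
  have "z \<otimes>\<^bsub>G'\<^esub> (y \<otimes>\<^bsub>G'\<^esub> x) \<in> carrier G'" "q (z \<otimes>\<^bsub>G'\<^esub> (y \<otimes>\<^bsub>G'\<^esub> x)) = \<one>\<^bsub>G\<^esub>"
    using car ker by (simp_all flip: xy)
  then have qz: "q z = \<one>\<^bsub>G\<^esub>"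
    using car ker by simp
  define w where "w = q b \<otimes>\<^bsub>G\<^esub> q a"
  have w: "w \<in> carrier G" using car by (simp add: w_def)
  \<comment> \<open>The torus cycle minus the image of \<open>?c\<close> is
    \<open>[1|w] - [1|1]\<close>, a combination of degenerate triangles; it is the boundary of
    \<open>[1|1|w]\<close>.\<close>
  have "bar_boundary G (frag_of [\<one>\<^bsub>G\<^esub>, \<one>\<^bsub>G\<^esub>, w]) \<in> bar_boundaries 2 G"
    using w by (intro bar_boundary_in_bar_boundaries) simp
  moreover have "torus_cycle (q a) (q b) - chain_map q ?c = bar_boundary G (frag_of [\<one>\<^bsub>G\<^esub>, \<one>\<^bsub>G\<^esub>, w])"
    using w car ker qz by (simp add: p_def torus_cycle_def frag_extend_diff w_def)
  ultimately have "bar_class 2 G (torus_cycle (q a) (q b)) = group_homology_map 2 G q (bar_class 2 G' ?c)"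
    by (simp add: group_homology_map_bar_class[OF assms(2,1,3)] bar_class_eqI[OF assms(1)])
  then show ?thesis
    using c by (auto simp: carrier_group_homology[OF assms(2)])
qed

section \<open>An extension of the free abelian group of rank two by the quaternion group\<close>

text \<open>The factor (-1)^k; negation of quadruples is componentwise.\<close>

definition quat_sign :: "int \<Rightarrow> int_quaternion \<Rightarrow> int_quaternion" where
  "quat_sign k p = (if even k then p else - p)"

text \<open>Conjugation by the m-th power of \<open>(1 + i + j + k) / 2\<close>.\<close>

definition quat_rot :: "int \<Rightarrow> int_quaternion \<Rightarrow> int_quaternion" where
  "quat_rot m = (\<lambda>(a, b, c, d). if m mod 3 = 0 then (a, b, c, d)
     else if m mod 3 = 1 then (a, d, b, c) else (a, c, d, b))"

section \<open>Signs and rotations of quaternions\<close>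

lemma quat_mult_assoc: "quat_mult (quat_mult p q) r = quat_mult p (quat_mult q r)"
  by (cases p, cases q, cases r) (simp add: algebra_simps)

lemma quat_sign_mult:
  "quat_mult (quat_sign k p) q = quat_sign k (quat_mult p q)"
  "quat_mult p (quat_sign k q) = quat_sign k (quat_mult p q)"
  by (cases p; cases q; simp add: quat_sign_def)+

lemma quat_sign_add: "quat_sign k (quat_sign l p) = quat_sign (k + l) p"
  by (simp add: quat_sign_def)

lemma quat_rot_mult: "quat_rot m (quat_mult p q) = quat_mult (quat_rot m p) (quat_rot m q)"
  by (cases p; cases q) (simp add: quat_rot_def algebra_simps)

lemma quat_rot_sign: "quat_rot m (quat_sign k p) = quat_sign k (quat_rot m p)"
  by (cases p) (simp add: quat_rot_def quat_sign_def)

lemma quat_rot_add: "quat_rot m (quat_rot n p) = quat_rot (m + n) p"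
proof -
  have "m mod 3 = 0 \<or> m mod 3 = 1 \<or> m mod 3 = 2" "n mod 3 = 0 \<or> n mod 3 = 1 \<or> n mod 3 = 2"
    by presburger+
  moreover have "(m + n) mod 3 = (m mod 3 + n mod 3) mod 3"
    by (simp add: mod_add_eq)
  ultimately show ?thesis
    by (cases p) (auto simp: quat_rot_def)
qed

lemma quat_rot_0 [simp]: "quat_rot 0 p = p"
  by (cases p) (simp add: quat_rot_def)

section \<open>The quaternion group\<close>

lemma mult_Q8 [simp]: "p \<otimes>\<^bsub>Q8\<^esub> q = quat_mult p q"
  by (simp add: Q8_def)

lemma one_Q8 [simp]: "\<one>\<^bsub>Q8\<^esub> = (1, 0, 0, 0)"
  by (simp add: Q8_def)

lemma Q8_mult_closed: "\<lbrakk>p \<in> carrier Q8; q \<in> carrier Q8\<rbrakk> \<Longrightarrow> quat_mult p q \<in> carrier Q8"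
  by (auto simp: Q8_def)

lemma Q8_sign_closed: "p \<in> carrier Q8 \<Longrightarrow> quat_sign k p \<in> carrier Q8"
  by (auto simp: Q8_def quat_sign_def)

lemma Q8_rot_closed: "p \<in> carrier Q8 \<Longrightarrow> quat_rot m p \<in> carrier Q8"
  by (cases "m mod 3 = 0"; cases "m mod 3 = 1") (auto simp: Q8_def quat_rot_def)

lemma Q8_l_inv: "p \<in> carrier Q8 \<Longrightarrow> \<exists>q \<in> carrier Q8. quat_mult q p = (1, 0, 0, 0)"
  by (auto simp: Q8_def)

lemma Q8_one: "(1, 0, 0, 0) \<in> carrier Q8"
  by (simp add: Q8_def)

lemma quat_mult_one [simp]: "quat_mult (1, 0, 0, 0) p = p" "quat_mult p (1, 0, 0, 0) = p"
  by (cases p; simp)+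

lemma group_Q8: "group Q8"
proof (rule groupI)
  fix p assume "p \<in> carrier Q8"
  then show "\<exists>q \<in> carrier Q8. q \<otimes>\<^bsub>Q8\<^esub> p = \<one>\<^bsub>Q8\<^esub>"
    using Q8_l_inv by simp
qed (simp_all add: Q8_mult_closed Q8_one quat_mult_assoc)

text \<open>The triple \<open>(p, m, n)\<close> stands for \<open>p a^m b^n\<close>. In a product,
  \<open>a^m\<close> acts on \<open>q\<close> by rotation, \<open>b^n\<close> commutes with
  \<open>q\<close>, and moving \<open>b^n\<close> past \<open>a^m'\<close> costs the sign (-1)^(n
  m').\<close>

definition ext_group :: "(int_quaternion \<times> int \<times> int) monoid" where
  "ext_group = \<lparr>carrier = carrier Q8 \<times> UNIV,
     monoid.mult = (\<lambda>(p, m, n) (q, m', n'). (quat_sign (n * m') (quat_mult p (quat_rot m q)), m + m', n + n')),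
     one = ((1, 0, 0, 0), 0, 0)\<rparr>"

lemma ext_group_mult [simp]:
  "(p, m, n) \<otimes>\<^bsub>ext_group\<^esub> (q, m', n') = (quat_sign (n * m') (quat_mult p (quat_rot m q)), m + m', n + n')"
  by (simp add: ext_group_def)

lemma ext_group_carrier [simp]: "(p, x) \<in> carrier ext_group \<longleftrightarrow> p \<in> carrier Q8"
  by (simp add: ext_group_def)

lemma group_ext_group: "group ext_group"
proof (rule groupI)
  fix u v w :: "int_quaternion \<times> int \<times> int"
  obtain p m n q m' n' r k l where "u = (p, m, n)" "v = (q, m', n')" "w = (r, k, l)"
    by (metis prod.exhaust)
  \<comment> \<open>Both sides carry the sign exponent \<open>n m' + n k + n' k\<close>.\<close>
  then show "u \<otimes>\<^bsub>ext_group\<^esub> v \<otimes>\<^bsub>ext_group\<^esub> w = u \<otimes>\<^bsub>ext_group\<^esub> (v \<otimes>\<^bsub>ext_group\<^esub> w)"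
    by (simp add: quat_sign_mult quat_rot_mult quat_rot_sign quat_rot_add quat_sign_add
        quat_mult_assoc algebra_simps)
next
  fix u v assume "u \<in> carrier ext_group" "v \<in> carrier ext_group"
  then show "u \<otimes>\<^bsub>ext_group\<^esub> v \<in> carrier ext_group"
    by (cases u; cases v) (simp add: Q8_mult_closed Q8_sign_closed Q8_rot_closed)
next
  fix u assume "u \<in> carrier ext_group"
  then obtain p m n where u: "u = (p, m, n)" "p \<in> carrier Q8"
    by (metis ext_group_carrier prod.exhaust)
  then show "\<one>\<^bsub>ext_group\<^esub> \<otimes>\<^bsub>ext_group\<^esub> u = u"
    by (simp add: ext_group_def quat_sign_def)
  obtain q where q: "q \<in> carrier Q8" "quat_mult q p = (1, 0, 0, 0)"
    using Q8_l_inv u by blast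
  \<comment> \<open>With \<open>q\<close> inverse to \<open>p\<close>, this is
    \<open>b^(-n) a^(-m) q\<close> in normal form; the sign comes from reordering the powers of
    \<open>a\<close> and \<open>b\<close>.\<close>
  let ?v = "(quat_sign (n * m) (quat_rot (- m) q), - m, - n)"
  have "?v \<otimes>\<^bsub>ext_group\<^esub> u = \<one>\<^bsub>ext_group\<^esub>"
    using q(2) by (simp add: u quat_sign_mult quat_sign_add flip: quat_rot_mult)
      (simp add: ext_group_def quat_sign_def quat_rot_def)
  then show "\<exists>v \<in> carrier ext_group. v \<otimes>\<^bsub>ext_group\<^esub> u = \<one>\<^bsub>ext_group\<^esub>"
    using q(1) by (intro bexI[of _ ?v]) (simp_all add: Q8_sign_closed Q8_rot_closed)
qed (simp add: ext_group_def Q8_one)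

text \<open>Commuting would mean \<open>p rot(q) = - q p\<close>, the sign arising from
  \<open>b a = - a b\<close>. If q is 1 or -1, it is central and fixed by the rotation; otherwise
  the rotation moves its axis, while conjugation by \<open>p\<close> changes it only by a sign. The
  proof checks all pairs.\<close>

lemma no_commuting_lift:
  assumes "p \<in> carrier Q8" "q \<in> carrier Q8"
  shows "(p, 1, 0) \<otimes>\<^bsub>ext_group\<^esub> (q, 0, 1) \<noteq> (q, 0, 1) \<otimes>\<^bsub>ext_group\<^esub> (p, 1, 0)"
proof -
  have "quat_mult p (quat_rot 1 q) \<noteq> - quat_mult q p"
  proof -
    have "quat_rot 1 (a, b, c, d) = (a, d, b, c)" for a b c d
      by (simp add: quat_rot_def)
    then show ?thesis
      using assms unfolding Q8_def by (simp only: partial_object.simps insert_iff empty_iff) (elim disjE; simp)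
  qed
  then show ?thesis
    by (simp add: quat_sign_def)
qed

lemma short_exact_ext_group:
  "short_exact Z_squared ext_group Q8 snd (\<lambda>p. (p, 0, 0))"
proof -
  have "(\<lambda>p. (p, 0, 0)) \<in> mon Q8 ext_group"
    by (auto simp: mon_def hom_def inj_on_def quat_sign_def)
  moreover have "snd \<in> epi ext_group Z_squared"
    using Q8_one by (force simp: epi_def hom_def ext_group_def)
  moreover have "(\<lambda>p. (p, 0, 0)) ` carrier Q8 = kernel ext_group Z_squared snd"
    by (auto simp: kernel_def ext_group_def)
  ultimately show ?thesis
    by (simp add: short_exact_def group_Q8 group_ext_group group_Z_squared)
qed

section \<open>Transport to the natural numbers and conclusion\<close>

theorem theorem4:
  shows "\<exists>(G :: nat monoid) (G' :: nat monoid) (i :: int_quaternion \<Rightarrow> nat) (q :: nat \<Rightarrow> nat)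
           (\<alpha> :: nat) (\<beta> :: nat) \<kappa>.
           short_exact G G' Q8 q i \<and>
           \<alpha> \<in> carrier G \<and> \<beta> \<in> carrier G \<and> \<alpha> \<otimes>\<^bsub>G\<^esub> \<beta> = \<beta> \<otimes>\<^bsub>G\<^esub> \<alpha> \<and>
           generate G {\<alpha>, \<beta>} = carrier G \<and>
           is_kappa G \<alpha> \<beta> \<kappa> \<and>
           \<kappa> \<in> group_homology_map 2 G q ` carrier (group_homology 2 G') \<and>
           commuting_lifts G' \<alpha> \<beta> q = {}"
proof -
  \<comment> \<open>The carriers are countable, so injective encodings carry Z^2 and the extension
    to isomorphic groups of natural numbers; \<open>q\<close> is the projection conjugated by
    them.\<close>
  define e :: "int \<times> int \<Rightarrow> nat" where "e = to_nat"
  define e' :: "int_quaternion \<times> int \<times> int \<Rightarrow> nat" where "e' = to_nat"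
  define G where "G = image_group e Z_squared"
  define G' where "G' = image_group e' ext_group"
  define q where "q = e \<circ> snd \<circ> inv_into (carrier ext_group) e'"
  have inj: "inj e" "inj e'" by (simp_all add: e_def e'_def)
  interpret Z: group Z_squared by (rule group_Z_squared)
  interpret X: group ext_group by (rule group_ext_group)
  have e_iso: "e \<in> iso Z_squared G" and G: "group G"
    using inj_imp_image_group_iso[of e Z_squared] Z.inj_imp_image_group_is_group[of e] inj(1)
    by (simp_all add: G_def)
  have e'_iso: "e' \<in> iso ext_group G'" and G': "group G'"
    using inj_imp_image_group_iso[of e' ext_group] X.inj_imp_image_group_is_group[of e']
      inj_on_subset[OF inj(2) subset_UNIV]
    by (simp_all add: G'_def)
  have e_hom: "e \<in> hom Z_squared G" and e'_hom: "e' \<in> hom ext_group G'"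
    using e_iso e'_iso by (simp_all add: iso_def)
  interpret e: group_hom Z_squared G e
    using G e_hom by (simp add: group_hom_def group_hom_axioms_def group_Z_squared)
  interpret e': group_hom ext_group G' e'
    using G' e'_hom by (simp add: group_hom_def group_hom_axioms_def group_ext_group)
  have carG: "carrier G = range e" and carG': "carrier G' = e' ` carrier ext_group"
    by (simp_all add: G_def G'_def image_group_carrier)
  have q_e': "q (e' u) = e (snd u)" if "u \<in> carrier ext_group" for u
    using that inj_on_subset[OF inj(2) subset_UNIV] by (simp add: q_def inv_into_f_f)
  have ex: "short_exact G G' Q8 q (\<lambda>p. e' (p, 0, 0))"
  proof -
    have hom_i: "(\<lambda>p. (p, 0, 0)) \<in> hom Q8 ext_group" and inj_i: "inj (\<lambda>p. (p, 0 :: int, 0 :: int))"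
      and epi: "snd \<in> epi ext_group Z_squared"
      and ker: "(\<lambda>p. (p, 0, 0)) ` carrier Q8 = kernel ext_group Z_squared snd"
      using short_exact_ext_group by (simp_all add: short_exact_def mon_def inj_on_def)
    have "(\<lambda>p. e' (p, 0, 0)) \<in> mon Q8 G'"
      using hom_compose[OF hom_i e'_hom] inj_on_subset[OF inj_compose[OF inj(2) inj_i] subset_UNIV]
      by (simp add: mon_def o_def)
    moreover have "q \<in> hom G' G"
    proof (rule homI)
      fix x y assume "x \<in> carrier G'" "y \<in> carrier G'"
      then obtain u v where uv: "x = e' u" "y = e' v" "u \<in> carrier ext_group" "v \<in> carrier ext_group"
        by (auto simp: carG')
      then show "q (x \<otimes>\<^bsub>G'\<^esub> y) = q x \<otimes>\<^bsub>G\<^esub> q y"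
        using hom_mult[of snd ext_group Z_squared] epi
        by (simp add: q_e' epi_def flip: e'.hom_mult e.hom_mult)
    qed (auto simp: carG' carG q_e')
    moreover have "q ` carrier G' = carrier G"
      using epi by (simp add: carG' image_image q_e' carG epi_def flip: image_image[of e snd])
    moreover have "(\<lambda>p. e' (p, 0, 0)) ` carrier Q8 = kernel G' G q"
    proof -
      have "kernel G' G q = e' ` kernel ext_group Z_squared snd"
        using inj(1) by (auto simp: kernel_def carG' q_e' inj_eq simp flip: e.hom_one)
      then show ?thesis by (simp add: image_image flip: ker)
    qed
    ultimately show ?thesis
      by (simp add: short_exact_def epi_def group_Q8 G G')
  qed
  let ?\<alpha> = "e (1, 0)" and ?\<beta> = "e (0, 1)"
  have "?\<alpha> \<otimes>\<^bsub>G\<^esub> ?\<beta> = ?\<beta> \<otimes>\<^bsub>G\<^esub> ?\<alpha>"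
    by (simp flip: e.hom_mult)
  moreover have "generate G {?\<alpha>, ?\<beta>} = carrier G"
    using e.generate_img[of "{(1, 0), (0, 1)}"] by (simp add: generate_Z_squared carG)
  moreover have "is_kappa G ?\<alpha> ?\<beta> (bar_class 2 G (torus_cycle ?\<alpha> ?\<beta>))"
    by (rule is_kappa_torus_cycle[OF G e_hom]) simp_all
  moreover have "bar_class 2 G (torus_cycle ?\<alpha> ?\<beta>)
      \<in> group_homology_map 2 G q ` carrier (group_homology 2 G')"
  proof -
    \<comment> \<open>Here \<open>?a\<close> and \<open>?b\<close> lift the generators,
      \<open>?x\<close> and \<open>?y\<close> are i and j in the kernel, and \<open>?z\<close> is
      -1, the commutator of both pairs.\<close>
    let ?a = "((1, 0, 0, 0), 1, 0) :: int_quaternion \<times> int \<times> int"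
      and ?b = "((1, 0, 0, 0), 0, 1) :: int_quaternion \<times> int \<times> int"
      and ?x = "((0, 1, 0, 0), 0, 0) :: int_quaternion \<times> int \<times> int"
      and ?y = "((0, 0, 1, 0), 0, 0) :: int_quaternion \<times> int \<times> int"
      and ?z = "((- 1, 0, 0, 0), 0, 0) :: int_quaternion \<times> int \<times> int"
    have car: "?a \<in> carrier ext_group" "?b \<in> carrier ext_group" "?x \<in> carrier ext_group"
      "?y \<in> carrier ext_group" "?z \<in> carrier ext_group"
      by (simp_all add: Q8_def)
    have "?a \<otimes>\<^bsub>ext_group\<^esub> ?b = ?z \<otimes>\<^bsub>ext_group\<^esub> (?b \<otimes>\<^bsub>ext_group\<^esub> ?a)"
      "?x \<otimes>\<^bsub>ext_group\<^esub> ?y = ?z \<otimes>\<^bsub>ext_group\<^esub> (?y \<otimes>\<^bsub>ext_group\<^esub> ?x)"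
      by (simp_all add: quat_sign_def quat_rot_def)
    then have "e' ?a \<otimes>\<^bsub>G'\<^esub> e' ?b = e' ?z \<otimes>\<^bsub>G'\<^esub> (e' ?b \<otimes>\<^bsub>G'\<^esub> e' ?a)"
      "e' ?x \<otimes>\<^bsub>G'\<^esub> e' ?y = e' ?z \<otimes>\<^bsub>G'\<^esub> (e' ?y \<otimes>\<^bsub>G'\<^esub> e' ?x)"
      using car by (simp_all only: e'.hom_mult[symmetric] X.m_closed)
    moreover have "q \<in> hom G' G"
      using ex by (simp add: short_exact_def epi_def)
    moreover have "q (e' ?x) = \<one>\<^bsub>G\<^esub>" "q (e' ?y) = \<one>\<^bsub>G\<^esub>" "q (e' ?a) = ?\<alpha>" "q (e' ?b) = ?\<beta>"
      using car by (simp_all add: q_e' zero_prod_def flip: e.hom_one)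
    ultimately show ?thesis
      using torus_class_in_image[OF G G', of q "e' ?a" "e' ?b" "e' ?x" "e' ?y" "e' ?z"] car
      by (simp add: e'.hom_closed)
  qed
  moreover have "commuting_lifts G' ?\<alpha> ?\<beta> q = {}"
  proof -
    have "x \<otimes>\<^bsub>G'\<^esub> y \<noteq> y \<otimes>\<^bsub>G'\<^esub> x"
      if xy: "x \<in> carrier G'" "y \<in> carrier G'" "q x = ?\<alpha>" "q y = ?\<beta>" for x y
    proof -
      obtain u v where uv: "x = e' u" "y = e' v" "u \<in> carrier ext_group" "v \<in> carrier ext_group"
        using xy by (auto simp: carG')
      \<comment> \<open>Injectivity of \<open>e\<close> recovers the Z^2-coordinates from the values
        of \<open>q\<close>, so the lifts have the form excluded by
        \<open>no_commuting_lift\<close>.\<close>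
      then have "snd u = (1, 0)" "snd v = (0, 1)"
        using xy inj(1) by (simp_all add: q_e' inj_eq)
      then have "u \<otimes>\<^bsub>ext_group\<^esub> v \<noteq> v \<otimes>\<^bsub>ext_group\<^esub> u"
        using no_commuting_lift uv(3,4) by (metis ext_group_carrier prod.collapse)
      then show ?thesis
        using uv inj(2) by (simp add: inj_eq flip: e'.hom_mult)
    qed
    then show ?thesis by (auto simp: commuting_lifts_def)
  qed
  ultimately show ?thesis
    using ex by (metis (no_types, lifting) UNIV_I carG image_eqI)
qed

end
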